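(* Let $m,n,p\ge 1$ and $\ell,\lambda,\mu\ge 0$ be integers. Let $A\in\mathbb{R}^{(m+pn)\times(m+pn)}$ be a symmetric positive definite $B^3$-Arrowhead matrix with block-bandwidths $(\ell,\ell)$ and sub-block-bandwidth $\lambda+\mu$. Then $A$ has a reverse Cholesky factorisation $$A = L^\top L,\qquad L \text{ lower triangular},$$ where $L$ is a $B^3$-Arrowhead matrix with block-bandwidths $(\ell,0)$ and sub-block-bandwidth $\lambda+\mu$ (with the same block sizes $m,n,p$ and the same $\lambda,\mu$).
   Context: A (possibly rectangular) matrix $M=(M_{kj})$ is banded with bandwidths $(l,u)$ if $M_{kj}=0$ whenever $k-j>l$ or $j-k>u$. A block matrix is block-banded with block-bandwidths $(l,u)$ if its $(K,J)$ block is zero whenever $K-J>l$ or $J-K>u$. A Banded-Block-Banded-Arrowhead ($B^3$-Arrowhead) matrix $A\in\mathbb{R}^{(m+pn)\times(m+pn)}$ with block-bandwidths $(\ell,u)$ and sub-block-bandwidth $\lambda+\mu$ is a matrix partitioned into blocks, with one first block of size $m$ followed by $p$ blocks of size $n$ (in both rows and columns), such that: 1. it is block-banded with block-bandwidths $(\ell,u)$; 2. the top-left block $A_0\in\mathbb{R}^{m\times m}$ is banded with bandwidths $(\lambda+\mu,\lambda+\mu)$; 3. the remaining blocks in the first block row, $B_k\in\mathbb{R}^{m\times n}$, have bandwidths $(\lambda,\mu)$; 4. the remaining blocks in the first block column, $C_k\in\mathbb{R}^{n\times m}$, have bandwidths $(\mu,\lambda)$; 5. all other blocks $D_{k,j}\in\mathbb{R}^{n\times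 n}$ are diagonal. A reverse Cholesky factorisation of a symmetric positive definite matrix $A$ is a factorisation $A=L^\top L$ with $L$ lower triangular. *)

theory Defs
  imports "Jordan_Normal_Form.Matrix"
begin

text \<open>
  Matrix entries and blocks are indexed from 0. A matrix in \<open>carrier_mat (m + p * n) (m + p * n)\<close>
  is partitioned, in rows and in columns, into block 0 of size \<open>m\<close> and blocks \<open>1, ..., p\<close> of
  size \<open>n\<close>. All bandwidths are natural numbers, and inequalities such as \<open>k - j > l\<close> are written
  \<open>k > j + l\<close> because subtraction on \<open>nat\<close> truncates.
\<close>

definition banded :: "nat \<Rightarrow> nat \<Rightarrow> 'a::zero mat \<Rightarrow> bool" where
  "banded l u M \<longleftrightarrow>
    (\<forall>k < dim_row M. \<forall>j < dim_col M. k > j + l \<or> j > k + u \<longrightarrow> M $$ (k, j) = 0)"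

definition block_size :: "nat \<Rightarrow> nat \<Rightarrow> nat \<Rightarrow> nat" where
  "block_size m n K = (if K = 0 then m else n)"

definition block_start :: "nat \<Rightarrow> nat \<Rightarrow> nat \<Rightarrow> nat" where
  "block_start m n K = (\<Sum>I<K. block_size m n I)"

definition block :: "nat \<Rightarrow> nat \<Rightarrow> 'a mat \<Rightarrow> nat \<Rightarrow> nat \<Rightarrow> 'a mat" where
  "block m n A K J = mat (block_size m n K) (block_size m n J)
    (\<lambda>(i, j). A $$ (block_start m n K + i, block_start m n J + j))"

definition block_banded :: "nat \<Rightarrow> nat \<Rightarrow> nat \<Rightarrow> nat \<Rightarrow> nat \<Rightarrow> 'a::zero mat \<Rightarrow> bool" where
  "block_banded m n p l u A \<longleftrightarrow>
    (\<forall>K \<le> p. \<forall>J \<le> p. K > J + l \<or> J > K + u \<longrightarrow>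
      block m n A K J = 0\<^sub>m (block_size m n K) (block_size m n J))"

text \<open>
  The sub-block-bandwidth of a \<open>B\<^sup>3\<close>-Arrowhead matrix is the formal sum of \<open>lam\<close> and \<open>mu\<close>:
  both summands are parameters, since the off-diagonal arrowhead blocks depend on them separately.
\<close>

definition B3_arrowhead ::
  "nat \<Rightarrow> nat \<Rightarrow> nat \<Rightarrow> nat \<Rightarrow> nat \<Rightarrow> nat \<Rightarrow> nat \<Rightarrow> 'a::zero mat \<Rightarrow> bool" where
  "B3_arrowhead m n p l u lam mu A \<longleftrightarrow>
    A \<in> carrier_mat (m + p * n) (m + p * n) \<and>
    block_banded m n p l u A \<and>
    banded (lam + mu) (lam + mu) (block m n A 0 0) \<and>
    (\<forall>k \<in> {1..p}. banded lam mu (block m n A 0 k)) \<and>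
    (\<forall>k \<in> {1..p}. banded mu lam (block m n A k 0)) \<and>
    (\<forall>k \<in> {1..p}. \<forall>j \<in> {1..p}. diagonal_mat (block m n A k j))"

definition symmetric_positive_definite :: "real mat \<Rightarrow> bool" where
  "symmetric_positive_definite A \<longleftrightarrow>
    square_mat A \<and> transpose_mat A = A \<and>
    (\<forall>x \<in> carrier_vec (dim_row A). x \<noteq> 0\<^sub>v (dim_row A) \<longrightarrow> x \<bullet> (A *\<^sub>v x) > 0)"

definition lower_triangular :: "'a::zero mat \<Rightarrow> bool" where
  "lower_triangular L \<longleftrightarrow> (\<forall>i < dim_row L. \<forall>j < dim_col L. i < j \<longrightarrow> L $$ (i, j) = 0)"

definition reverse_cholesky :: "real mat \<Rightarrow> real mat \<Rightarrow> bool" where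
  "reverse_cholesky A L \<longleftrightarrow>
    L \<in> carrier_mat (dim_row A) (dim_row A) \<and> lower_triangular L \<and> A = transpose_mat L * L"

end

theory Submission
  imports Defs
begin

text \<open>
  Eliminate the indices from the last to the first. Splitting off the last row \<open>v\<^sup>T\<close> and the last
  diagonal entry \<open>a\<close> of \<open>A\<close>, the last row of \<open>L\<close> is \<open>(v\<^sup>T / sqrt a, sqrt a)\<close>, and the rest of \<open>L\<close>
  factorises the Schur complement \<open>A' - v v\<^sup>T / a\<close>, which is again symmetric positive definite.
  There is no fill-in as soon as any two positions \<open>i, j < k\<close> that are coupled to \<open>k\<close> are coupled
  to each other, and the \<open>B\<^sup>3\<close>-Arrowhead pattern has this property.
\<close>

section \<open>Reverse Cholesky factorisation within a sparsity pattern\<close>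

text \<open>Entries are a function on all of \<open>nat\<close>, so that an induction on
  \<open>N\<close> passes to the leading part without resizing a matrix.\<close>

definition pos_def_on :: "nat \<Rightarrow> (nat \<Rightarrow> nat \<Rightarrow> real) \<Rightarrow> bool" where
  "pos_def_on N a \<longleftrightarrow>
    (\<forall>x. (\<exists>i<N. x i \<noteq> 0) \<longrightarrow> (\<Sum>i<N. \<Sum>j<N. x i * a i j * x j) > 0)"

lemma pos_def_on_diag_pos:
  assumes "pos_def_on N a" and "k < N"
  shows "a k k > 0"
proof -
  \<comment> \<open>The test vector is the \<open>k\<close>-th unit vector.\<close>
  have "(\<Sum>i<N. \<Sum>j<N. of_bool (i = k) * a i j * of_bool (j = k)) = a k k"
  proof -
    have "(\<Sum>i<N. \<Sum>j<N. of_bool (i = k) * a i j * of_bool (j = k))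
        = (\<Sum>i<N. if i = k then (\<Sum>j<N. if j = k then a i j else 0) else 0)"
      by (intro sum.cong) auto
    then show ?thesis
      using assms(2) by simp
  qed
  moreover have "(\<Sum>i<N. \<Sum>j<N. of_bool (i = k) * a i j * of_bool (j = k)) > 0"
    using assms unfolding pos_def_on_def by (auto dest!: spec[where x = "\<lambda>i. of_bool (i = k)"])
  ultimately show ?thesis by simp
qed

lemma pos_def_on_schur_complement:
  assumes pd: "pos_def_on (Suc N) a"
    and sym: "\<And>i. i < N \<Longrightarrow> a i N = a N i"
  shows "pos_def_on N (\<lambda>i j. a i j - a N i * a N j / a N N)"
  unfolding pos_def_on_def
proof (intro allI impI)
  fix x :: "nat \<Rightarrow> real"
  assume nz: "\<exists>i<N. x i \<noteq> 0"
  define s where "s = (\<Sum>i<N. x i * a N i)"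
  \<comment> \<open>\<open>- s / a N N\<close> is the last entry of the minimiser of the quadratic form of \<open>a\<close> among the
    extensions of \<open>x\<close>, and the minimum is the quadratic form of the Schur complement.\<close>
  define y where "y = x(N := - s / a N N)"
  have pos: "a N N > 0"
    using pos_def_on_diag_pos[OF pd] by simp
  have yN: "y N = - s / a N N" and y: "\<And>i. i < N \<Longrightarrow> y i = x i"
    by (auto simp: y_def)
  have row: "(\<Sum>j<N. y N * a N j * x j) = y N * s"
    by (simp add: s_def sum_distrib_left mult_ac)
  have col: "(\<Sum>i<N. x i * a i N * y N) = y N * s"
    by (simp add: s_def sum_distrib_left sym mult_ac)
  have square: "(\<Sum>i<N. \<Sum>j<N. x i * (a N i * a N j / a N N) * x j) = s * s / a N N"
    by (simp add: s_def sum_product sum_divide_distrib mult_ac)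
  obtain i where "i < N" "x i \<noteq> 0"
    using nz by blast
  then have "\<exists>i<Suc N. y i \<noteq> 0"
    using y by (intro exI[of _ i]) simp
  then have "(\<Sum>i<Suc N. \<Sum>j<Suc N. y i * a i j * y j) > 0"
    using pd unfolding pos_def_on_def by blast
  also have "(\<Sum>i<Suc N. \<Sum>j<Suc N. y i * a i j * y j)
      = (\<Sum>i<N. \<Sum>j<N. x i * a i j * x j) + y N * s + y N * s + y N * a N N * y N"
    by (simp add: sum.distrib row col y)
  also have "\<dots> = (\<Sum>i<N. \<Sum>j<N. x i * a i j * x j) - s * s / a N N"
    using pos by (simp add: yN field_simps)
  also have "\<dots> = (\<Sum>i<N. \<Sum>j<N. x i * (a i j - a N i * a N j / a N N) * x j)"
    by (simp add: square[symmetric] sum_subtractf algebra_simps)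
  finally show "(\<Sum>i<N. \<Sum>j<N. x i * (a i j - a N i * a N j / a N N) * x j) > 0" .
qed

text \<open>The Schur update at \<open>(i, j)\<close> is nonzero only if \<open>a N i\<close> and
  \<open>a N j\<close> both are. The last assumption, at \<open>k = N\<close>, then puts
  \<open>(i, j)\<close> in \<open>P\<close>, so the complement satisfies the hypotheses for the
  induction.\<close>

lemma reverse_cholesky_without_fill_in:
  fixes a :: "nat \<Rightarrow> nat \<Rightarrow> real" and P :: "nat \<Rightarrow> nat \<Rightarrow> bool"
  assumes "pos_def_on N a"
    and "\<And>i j. i < N \<Longrightarrow> j < N \<Longrightarrow> a i j = a j i"
    and "\<And>i j. i < N \<Longrightarrow> j < N \<Longrightarrow> a i j \<noteq> 0 \<Longrightarrow> P i j"
    and "\<And>i j k. k < N \<Longrightarrow> i < k \<Longrightarrow> j < k \<Longrightarrow> P k i \<Longrightarrow> P k j \<Longrightarrow> P i j"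
  shows "\<exists>b. (\<forall>i<N. \<forall>j<N. a i j = (\<Sum>k<N. b k i * b k j)) \<and>
    (\<forall>i j. i < j \<longrightarrow> b i j = 0) \<and> (\<forall>i<N. \<forall>j<N. b i j \<noteq> 0 \<longrightarrow> P i j)"
  using assms
proof (induction N arbitrary: a)
  case 0
  show ?case by (intro exI[of _ "\<lambda>_ _. 0"]) simp
next
  case (Suc N)
  let ?s = "\<lambda>i j. a i j - a N i * a N j / a N N"
  have pos: "a N N > 0"
    using pos_def_on_diag_pos[OF Suc.prems(1)] by simp
  have "P i j" if "i < N" "j < N" "?s i j \<noteq> 0" for i j
  proof (cases "a i j = 0")
    case True
    with that have "a N i \<noteq> 0" "a N j \<noteq> 0" by auto
    then have "P N i" "P N j" using Suc.prems(3) that by auto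
    then show ?thesis using Suc.prems(4)[of N i j] that by simp
  qed (use Suc.prems(3) that in auto)
  moreover have "pos_def_on N ?s"
    using pos_def_on_schur_complement[OF Suc.prems(1)] Suc.prems(2) by simp
  moreover have "?s i j = ?s j i" if "i < N" "j < N" for i j
    using Suc.prems(2)[of i j] that by simp
  ultimately obtain b where b: "\<forall>i<N. \<forall>j<N. ?s i j = (\<Sum>k<N. b k i * b k j)"
    and low: "\<forall>i j. i < j \<longrightarrow> b i j = 0"
    and pat: "\<forall>i<N. \<forall>j<N. b i j \<noteq> 0 \<longrightarrow> P i j"
    using Suc.IH[of ?s] Suc.prems(4)[OF less_SucI] by blast
  \<comment> \<open>The row formula also covers the diagonal entry, as
    \<open>a N N / sqrt (a N N) = sqrt (a N N)\<close>. The test \<open>j \<le> i\<close> keeps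
    \<open>c\<close> lower triangular at all indices, also beyond \<open>N\<close>.\<close>
  define c where "c = (\<lambda>i j. if i < N then b i j else if j \<le> i then a N j / sqrt (a N N) else 0)"
  have cN: "c N j = a N j / sqrt (a N N)" if "j < Suc N" for j
    using that by (simp add: c_def)
  have last: "c N i * c N j = a N i * a N j / a N N" if "i < Suc N" "j < Suc N" for i j
    using pos that by (simp add: cN)
  have "a i j = (\<Sum>k<Suc N. c k i * c k j)" if ij: "i < Suc N" "j < Suc N" for i j
  proof (cases "i < N \<and> j < N")
    case True
    have "(\<Sum>k<Suc N. c k i * c k j) = (\<Sum>k<N. b k i * b k j) + a N i * a N j / a N N"
      using ij by (simp add: last) (simp add: c_def)
    then show ?thesis using b True by (metis diff_add_cancel)
  next
    case False
    then have "i = N \<or> j = N" using ij by auto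
    \<comment> \<open>Column \<open>N\<close> of the lower triangular \<open>b\<close> vanishes in
      rows below index \<open>N\<close>, so only the new row contributes to the last row and column
      of the product.\<close>
    then have "(\<Sum>k<N. c k i * c k j) = 0"
      using low by (intro sum.neutral) (auto simp: c_def)
    then show ?thesis
      using pos ij \<open>i = N \<or> j = N\<close> Suc.prems(2)[of i j] by (auto simp: last)
  qed
  moreover have "\<forall>i j. i < j \<longrightarrow> c i j = 0"
    using low by (simp add: c_def)
  moreover have "P i j" if "i < Suc N" "j < Suc N" "c i j \<noteq> 0" for i j
  proof (cases "i < N")
    case True
    then have "b i j \<noteq> 0" using that by (simp add: c_def)
    then have "j < N" using low True by (metis linorder_not_less order_less_le_trans)
    then show ?thesis using pat True \<open>b i j \<noteq> 0\<close> by blast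
  next
    case False
    then have "i = N" using that by simp
    then show ?thesis using that Suc.prems(3)[of N j] by (auto simp: cN)
  qed
  ultimately show ?case by blast
qed

section \<open>Block and offset coordinates of an index\<close>

lemma block_start_simps [simp]:
  "block_start m n 0 = 0" "block_start m n (Suc K) = m + K * n"
proof -
  show "block_start m n 0 = 0"
    by (simp add: block_start_def)
  show "block_start m n (Suc K) = m + K * n"
    by (induction K) (simp_all add: block_start_def block_size_def)
qed

text \<open>Together with \<open>offset_of\<close>, this inverts the map from a block
  \<open>K\<close> and an offset \<open>r\<close> to \<open>block_start m n K + r\<close>.\<close>

definition block_of :: "nat \<Rightarrow> nat \<Rightarrow> nat \<Rightarrow> nat" where
  "block_of m n i = (if i < m then 0 else Suc ((i - m) div n))"

definition offset_of :: "nat \<Rightarrow> nat \<Rightarrow> nat \<Rightarrow> nat" where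
  "offset_of m n i = (if i < m then i else (i - m) mod n)"

lemma block_of_start_add [simp]: "r < block_size m n K \<Longrightarrow> block_of m n (block_start m n K + r) = K"
  by (cases K) (auto simp: block_size_def block_of_def)

lemma offset_of_start_add [simp]:
  "r < block_size m n K \<Longrightarrow> offset_of m n (block_start m n K + r) = r"
  by (cases K) (auto simp: block_size_def offset_of_def)

lemma block_start_offset: "block_start m n (block_of m n i) + offset_of m n i = i"
  by (simp add: block_of_def offset_of_def)

lemma offset_of_less: "n \<ge> 1 \<Longrightarrow> offset_of m n i < block_size m n (block_of m n i)"
  by (simp add: block_size_def block_of_def offset_of_def)

lemma block_of_mono: "i \<le> j \<Longrightarrow> block_of m n i \<le> block_of m n j"
  by (auto simp: block_of_def intro!: div_le_mono)

lemma block_of_le: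
  assumes "i < m + p * n"
  shows "block_of m n i \<le> p"
proof (cases "i < m")
  case False
  then have "i - m < p * n" using assms by linarith
  then have "(i - m) div n < p" by (rule less_mult_imp_div_less)
  then show ?thesis using False by (simp add: block_of_def)
qed (simp add: block_of_def)

lemma block_start_add_less:
  assumes "K \<le> p" and "r < block_size m n K"
  shows "block_start m n K + r < m + p * n"
proof (cases K)
  case (Suc k)
  then have "r < n" using assms by (simp add: block_size_def)
  then have "k * n + r < Suc k * n" by simp
  also have "\<dots> \<le> p * n" using assms Suc by (intro mult_le_mono1) simp
  finally show ?thesis using Suc by simp
qed (use assms in \<open>simp add: block_size_def\<close>)

section \<open>The arrowhead structure as a pattern of entries\<close>

text \<open>The positions where an entry may be nonzero: row block \<open>K\<close> with offset
  \<open>r\<close>, column block \<open>J\<close> with offset \<open>c\<close>. This contrapositive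
  form of the bandwidth conditions supplies the relation \<open>P\<close> of the
  elimination.\<close>

definition arrow_pattern ::
  "nat \<Rightarrow> nat \<Rightarrow> nat \<Rightarrow> nat \<Rightarrow> nat \<Rightarrow> nat \<Rightarrow> nat \<Rightarrow> nat \<Rightarrow> bool" where
  "arrow_pattern l u lam mu K r J c \<longleftrightarrow> K \<le> J + l \<and> J \<le> K + u \<and>
    (if K = 0 \<and> J = 0 then r \<le> c + (lam + mu) \<and> c \<le> r + (lam + mu)
     else if K = 0 then r \<le> c + lam \<and> c \<le> r + mu
     else if J = 0 then r \<le> c + mu \<and> c \<le> r + lam
     else r = c)"

lemma B3_arrowhead_iff_blockwise:
  "B3_arrowhead m n p l u lam mu A \<longleftrightarrow> A \<in> carrier_mat (m + p * n) (m + p * n) \<and>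
    (\<forall>K\<le>p. \<forall>J\<le>p. \<forall>r<block_size m n K. \<forall>c<block_size m n J.
      A $$ (block_start m n K + r, block_start m n J + c) \<noteq> 0 \<longrightarrow>
      arrow_pattern l u lam mu K r J c)"
  (is "_ \<longleftrightarrow> _ \<and> ?R")
proof -
  let ?a = "\<lambda>K r J c. A $$ (block_start m n K + r, block_start m n J + c)"
  have bb: "block_banded m n p l u A \<longleftrightarrow>
    (\<forall>K\<le>p. \<forall>J\<le>p. \<forall>r<block_size m n K. \<forall>c<block_size m n J.
      ?a K r J c \<noteq> 0 \<longrightarrow> K \<le> J + l \<and> J \<le> K + u)"
    unfolding block_banded_def block_def mat_eq_iff by (auto simp: not_le[symmetric])
  have bd: "banded l' u' (block m n A K J) \<longleftrightarrow>
    (\<forall>r<block_size m n K. \<forall>c<block_size m n J. ?a K r J c \<noteq> 0 \<longrightarrow> r \<le> c + l' \<and> c \<le> r + u')"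
    for l' u' K J
    unfolding banded_def block_def by (auto simp: not_le[symmetric])
  have dg: "diagonal_mat (block m n A K J) \<longleftrightarrow>
    (\<forall>r<block_size m n K. \<forall>c<block_size m n J. ?a K r J c \<noteq> 0 \<longrightarrow> r = c)" for K J
    unfolding diagonal_mat_def block_def by auto
  \<comment> \<open>One condition for every pair of blocks, which can be merged with
    block-bandedness pair by pair.\<close>
  let ?shape = "\<lambda>K J. if K = 0 \<and> J = 0 then banded (lam + mu) (lam + mu) (block m n A K J)
    else if K = 0 then banded lam mu (block m n A K J)
    else if J = 0 then banded mu lam (block m n A K J)
    else diagonal_mat (block m n A K J)"
  have zero_or: "(\<forall>K\<le>p. Q K) \<longleftrightarrow> Q 0 \<and> (\<forall>k\<in>{1..p}. Q k)" for Q :: "nat \<Rightarrow> bool"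
    by (metis atLeastAtMost_iff le0 less_one not_le)
  have split: "(\<forall>K\<le>p. \<forall>J\<le>p. Q K J) \<longleftrightarrow>
    Q 0 0 \<and> (\<forall>k\<in>{1..p}. Q 0 k) \<and> (\<forall>k\<in>{1..p}. Q k 0) \<and> (\<forall>k\<in>{1..p}. \<forall>j\<in>{1..p}. Q k j)"
    for Q :: "nat \<Rightarrow> nat \<Rightarrow> bool"
    unfolding zero_or by blast
  have "B3_arrowhead m n p l u lam mu A \<longleftrightarrow> A \<in> carrier_mat (m + p * n) (m + p * n) \<and>
    block_banded m n p l u A \<and> (\<forall>K\<le>p. \<forall>J\<le>p. ?shape K J)"
    unfolding B3_arrowhead_def split[of ?shape] by simp
  moreover have "(\<forall>r<block_size m n K. \<forall>c<block_size m n J.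
      ?a K r J c \<noteq> 0 \<longrightarrow> arrow_pattern l u lam mu K r J c) \<longleftrightarrow>
    (\<forall>r<block_size m n K. \<forall>c<block_size m n J. ?a K r J c \<noteq> 0 \<longrightarrow> K \<le> J + l \<and> J \<le> K + u) \<and>
    ?shape K J" for K J
    unfolding bd dg arrow_pattern_def by (cases "K = 0"; cases "J = 0") (simp_all, blast+)
  then have "block_banded m n p l u A \<and> (\<forall>K\<le>p. \<forall>J\<le>p. ?shape K J) \<longleftrightarrow> ?R"
    unfolding bb by (simp only:) blast
  ultimately show ?thesis by blast
qed

lemma B3_arrowhead_iff:
  assumes "n \<ge> 1"
  shows "B3_arrowhead m n p l u lam mu A \<longleftrightarrow> A \<in> carrier_mat (m + p * n) (m + p * n) \<and>
    (\<forall>i<m + p * n. \<forall>j<m + p * n. A $$ (i, j) \<noteq> 0 \<longrightarrow>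
      arrow_pattern l u lam mu (block_of m n i) (offset_of m n i) (block_of m n j) (offset_of m n j))"
proof -
  have "(\<forall>i<m + p * n. Q i) \<longleftrightarrow> (\<forall>K\<le>p. \<forall>r<block_size m n K. Q (block_start m n K + r))"
    for Q :: "nat \<Rightarrow> bool"
    by (metis assms block_of_le block_start_add_less block_start_offset offset_of_less)
  then show ?thesis
    unfolding B3_arrowhead_iff_blockwise by auto
qed

text \<open>Block distances: \<open>I \<le> K \<le> J + l\<close>, and symmetrically. Offsets for
  \<open>K > 0\<close>: a diagonal block forces equality with \<open>t\<close>, so a mixed pair
  inherits the band of its arrowhead block; for \<open>I = J = 0\<close>, the chain
  \<open>r \<le> t + lam \<le> c + mu + lam\<close> explains the bandwidth \<open>lam + mu\<close>
  of the top-left block. For \<open>K = 0\<close>, the ordering gives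
  \<open>c \<le> t \<le> r + (lam + mu)\<close>.\<close>

lemma arrow_pattern_no_fill_in:
  assumes "arrow_pattern l l lam mu K t I r" and "arrow_pattern l l lam mu K t J c"
    and "I \<le> K" and "J \<le> K"
    and "K = 0 \<Longrightarrow> r \<le> t" and "K = 0 \<Longrightarrow> c \<le> t"
  shows "arrow_pattern l l lam mu I r J c"
  using assms unfolding arrow_pattern_def by (auto split: if_splits)

section \<open>Factorising the arrowhead matrix\<close>

lemma pos_def_on_matI:
  assumes "symmetric_positive_definite A" and "A \<in> carrier_mat N N"
  shows "pos_def_on N (\<lambda>i j. A $$ (i, j))"
  unfolding pos_def_on_def
proof (intro allI impI)
  fix x :: "nat \<Rightarrow> real"
  assume "\<exists>i<N. x i \<noteq> 0"
  then have "vec N x \<noteq> 0\<^sub>v N" by (metis index_vec index_zero_vec(1))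
  then have "vec N x \<bullet> (A *\<^sub>v vec N x) > 0"
    using assms unfolding symmetric_positive_definite_def by auto
  also have "vec N x \<bullet> (A *\<^sub>v vec N x) = (\<Sum>i<N. \<Sum>j<N. x i * A $$ (i, j) * x j)"
    using assms(2)
    by (simp add: scalar_prod_def sum_distrib_left lessThan_atLeast0 mult.assoc)
  finally show "(\<Sum>i<N. \<Sum>j<N. x i * A $$ (i, j) * x j) > 0" .
qed

theorem theorem4p2:
  fixes m n p l lam mu :: nat and A :: "real mat"
  assumes "m \<ge> 1" and "n \<ge> 1" and "p \<ge> 1"
    and "symmetric_positive_definite A"
    and "B3_arrowhead m n p l l lam mu A"
  shows "\<exists>L. reverse_cholesky A L \<and> B3_arrowhead m n p l 0 lam mu L"
proof -
  define N where "N = m + p * n"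
  let ?P = "\<lambda>u i j. arrow_pattern l u lam mu
    (block_of m n i) (offset_of m n i) (block_of m n j) (offset_of m n j)"
  have A: "A \<in> carrier_mat N N"
    and pat: "\<And>i j. i < N \<Longrightarrow> j < N \<Longrightarrow> A $$ (i, j) \<noteq> 0 \<Longrightarrow> ?P l i j"
    using assms(5) unfolding B3_arrowhead_iff[OF assms(2)] N_def by auto
  have sym: "A $$ (i, j) = A $$ (j, i)" if "i < N" "j < N" for i j
    using assms(4) A that unfolding symmetric_positive_definite_def
    by (metis carrier_matD index_transpose_mat(1))
  have no_fill_in: "?P l i j" if "k < N" "i < k" "j < k" "?P l k i" "?P l k j" for i j k
  proof (rule arrow_pattern_no_fill_in[OF that(4,5)])
    show "block_of m n i \<le> block_of m n k" "block_of m n j \<le> block_of m n k"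
      using that by (auto intro: block_of_mono)
    \<comment> \<open>In block 0 the offset is the index itself, so the order of indices carries
      over.\<close>
    show "offset_of m n i \<le> offset_of m n k" "offset_of m n j \<le> offset_of m n k"
      if "block_of m n k = 0"
      using that \<open>i < k\<close> \<open>j < k\<close> by (auto simp: block_of_def offset_of_def split: if_splits)
  qed
  have "\<exists>b. (\<forall>i<N. \<forall>j<N. A $$ (i, j) = (\<Sum>k<N. b k i * b k j)) \<and>
    (\<forall>i j. i < j \<longrightarrow> b i j = 0) \<and> (\<forall>i<N. \<forall>j<N. b i j \<noteq> 0 \<longrightarrow> ?P l i j)"
    by (rule reverse_cholesky_without_fill_in[OF pos_def_on_matI[OF assms(4) A]])
      (fact sym pat no_fill_in)+
  then obtain b where b: "\<forall>i<N. \<forall>j<N. A $$ (i, j) = (\<Sum>k<N. b k i * b k j)"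
    and low: "\<forall>i j. i < j \<longrightarrow> b i j = 0"
    and pat_b: "\<forall>i<N. \<forall>j<N. b i j \<noteq> 0 \<longrightarrow> ?P l i j"
    by blast
  define L where "L = mat N N (\<lambda>(i, j). b i j)"
  have "A = transpose_mat L * L"
    using A b by (intro eq_matI) (auto simp: L_def scalar_prod_def lessThan_atLeast0)
  then have "reverse_cholesky A L"
    using A low by (simp add: reverse_cholesky_def lower_triangular_def L_def)
  \<comment> \<open>The upper block-bandwidth drops from \<open>l\<close> to 0 by triangularity:
    \<open>j \<le> i\<close> implies the same order of the blocks, and the rest of the pattern does
    not involve \<open>u\<close>.\<close>
  moreover have "?P 0 i j" if "i < N" "j < N" "b i j \<noteq> 0" for i j
  proof -
    have "j \<le> i" using low that(3) by (meson not_le)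
    then show ?thesis
      using pat_b that block_of_mono[of j i m n] by (simp add: arrow_pattern_def)
  qed
  then have "B3_arrowhead m n p l 0 lam mu L"
    unfolding B3_arrowhead_iff[OF assms(2)] N_def[symmetric] by (simp add: L_def)
  ultimately show ?thesis by blast
qed

end
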